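(* Let $\mathscr{T}=(V,E)$ be a countably infinite rooted and leafless directed tree and $\boldsymbol\lambda=\{\lambda_v\}_{v\in V^\circ}\subseteq(0,\infty)$. If $S_{\boldsymbol\lambda}\in\mathbf{B}(\ell^2(V))$ is left-invertible, then $S_{\boldsymbol\lambda}$ is reflexive.
   Context: A rooted directed tree $\mathscr{T}=(V,E)$ has a unique vertex $\mathsf{root}$ without parent; every other vertex $v$ has a unique parent $\mathsf{par}(v)$; $V^\circ=V\setminus\{\mathsf{root}\}$. The tree is leafless if every vertex has at least one child. $\ell^2(V)$ is the space of square-summable functions $V\to\mathbb{C}$. The weighted shift $S_{\boldsymbol\lambda}$ on $\mathscr{T}$ with weights $\boldsymbol\lambda$ is the operator in $\ell^2(V)$ given by $(S_{\boldsymbol\lambda}f)(v)=\lambda_vf(\mathsf{par}(v))$ for $v\in V^\circ$ and $(S_{\boldsymbol\lambda}f)(\mathsf{root})=0$, on its maximal domain; $\mathbf{B}(\cdot)$ denotes bounded everywhere defined operators. Left-invertible means having a bounded left inverse. For $A\in\mathbf{B}(H)$, $H$ a Hilbert space, $\mathcal{W}(A)$ is the smallest subalgebra of $\mathbf{B}(H)$ containing $A$ and the identity and closed in the weak operator topology. For an algebra $\mathcal{W}\subseteq\mathbf{B}(H)$, $\mathrm{Lat}\,\mathcal{W}$ is the set of closed subspaces invariant under every element of $\mathcal{W}$; for a family $\mathfrak{M}$ of subspaces, $\mathrm{Alg}\,\mathfrak{M}$ is the set of operators in $\mathbf{B}(H)$ leaving every member of $\mathfrak{M}$ invariant. $A$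 is reflexive if $\mathrm{Alg}\,\mathrm{Lat}\,\mathcal{W}(A)=\mathcal{W}(A)$. *)

theory Defs
  imports "HOL-Analysis.Analysis"
begin

section \<open>Complex Hilbert spaces\<close>

text \<open>
  The real inner product of \<^class>\<open>real_inner\<close> is the real part of the complex one,
  so the norm and the topology of the class are those of the complex Hilbert space.
  The complex inner product is linear in its first argument.
\<close>

class complex_hilbert = real_inner + complete_space +
  fixes scaleC :: "complex \<Rightarrow> 'a \<Rightarrow> 'a" (infixr \<open>*\<^sub>C\<close> 75)
    and cinner :: "'a \<Rightarrow> 'a \<Rightarrow> complex"
  assumes scaleC_add_right: "c *\<^sub>C (x + y) = c *\<^sub>C x + c *\<^sub>C y"
    and scaleC_add_left: "(c + d) *\<^sub>C x = c *\<^sub>C x + d *\<^sub>C x"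
    and scaleC_scaleC: "c *\<^sub>C (d *\<^sub>C x) = (c * d) *\<^sub>C x"
    and scaleC_of_real: "complex_of_real r *\<^sub>C x = r *\<^sub>R x"
    and cinner_commute: "cinner x y = cnj (cinner y x)"
    and cinner_add_left: "cinner (x + y) z = cinner x z + cinner y z"
    and cinner_scaleC_left: "cinner (c *\<^sub>C x) y = c * cinner x y"
    and Re_cinner: "Re (cinner x y) = inner x y"

definition bounded_clinear :: "('a::complex_hilbert \<Rightarrow> 'a) \<Rightarrow> bool" where
  "bounded_clinear A \<longleftrightarrow> bounded_linear A \<and> (\<forall>c x. A (c *\<^sub>C x) = c *\<^sub>C A x)"

definition bounded_operators :: "('a::complex_hilbert \<Rightarrow> 'a) set" where
  "bounded_operators = {A. bounded_clinear A}"

definition closed_csubspace :: "'a::complex_hilbert set \<Rightarrow> bool" where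
  "closed_csubspace M \<longleftrightarrow> closed M \<and> 0 \<in> M \<and> (\<forall>x\<in>M. \<forall>y\<in>M. x + y \<in> M)
     \<and> (\<forall>c. \<forall>x\<in>M. c *\<^sub>C x \<in> M)"

definition left_invertible :: "('a::complex_hilbert \<Rightarrow> 'a) \<Rightarrow> bool" where
  "left_invertible A \<longleftrightarrow> (\<exists>L\<in>bounded_operators. L \<circ> A = id)"

section \<open>Operator algebras and reflexivity\<close>

definition operator_subalgebra :: "('a::complex_hilbert \<Rightarrow> 'a) set \<Rightarrow> bool" where
  "operator_subalgebra W \<longleftrightarrow> W \<subseteq> bounded_operators \<and> (\<lambda>x. 0) \<in> W
     \<and> (\<forall>A\<in>W. \<forall>B\<in>W. (\<lambda>x. A x + B x) \<in> W)
     \<and> (\<forall>c. \<forall>A\<in>W. (\<lambda>x. c *\<^sub>C A x) \<in> W)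
     \<and> (\<forall>A\<in>W. \<forall>B\<in>W. A \<circ> B \<in> W)"

text \<open>
  The coarsest topology on the bounded operators for which every map
  \<open>A \<mapsto> \<langle>A x, y\<rangle>\<close> is continuous: the pullback of the topology of pointwise convergence
  on functions \<open>'a \<times> 'a \<Rightarrow> complex\<close>.
\<close>

definition weak_operator_topology :: "('a::complex_hilbert \<Rightarrow> 'a) topology" where
  "weak_operator_topology =
     pullback_topology bounded_operators (\<lambda>A (x, y). cinner (A x) y) euclidean"

definition W_alg :: "('a::complex_hilbert \<Rightarrow> 'a) \<Rightarrow> ('a \<Rightarrow> 'a) set" where
  "W_alg A = \<Inter> {W. operator_subalgebra W \<and> A \<in> W \<and> id \<in> W \<and> closedin weak_operator_topology W}"

definition Lat :: "('a::complex_hilbert \<Rightarrow> 'a) set \<Rightarrow> 'a set set" where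
  "Lat W = {M. closed_csubspace M \<and> (\<forall>A\<in>W. A ` M \<subseteq> M)}"

definition Alg :: "'a::complex_hilbert set set \<Rightarrow> ('a \<Rightarrow> 'a) set" where
  "Alg \<MM> = {A \<in> bounded_operators. \<forall>M\<in>\<MM>. A ` M \<subseteq> M}"

definition reflexive_operator :: "('a::complex_hilbert \<Rightarrow> 'a) \<Rightarrow> bool" where
  "reflexive_operator A \<longleftrightarrow> Alg (Lat (W_alg A)) = W_alg A"

section \<open>The space of square-summable functions\<close>

definition square_summable :: "('v \<Rightarrow> complex) \<Rightarrow> bool" where
  "square_summable f \<longleftrightarrow> (\<lambda>v. (cmod (f v))\<^sup>2) summable_on UNIV"

lemma square_summable_zero: "square_summable (\<lambda>v. 0)"
  by (simp add: square_summable_def)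

lemma square_summable_scale:
  assumes "square_summable f" shows "square_summable (\<lambda>v. c * f v)"
  using assms unfolding square_summable_def
  by (simp add: norm_mult power_mult_distrib summable_on_cmult_right)

lemma square_summable_add:
  assumes "square_summable f" "square_summable g" shows "square_summable (\<lambda>v. f v + g v)"
  unfolding square_summable_def
proof (rule summable_on_comparison_test)
  show "(\<lambda>v. 2 * (cmod (f v))\<^sup>2 + 2 * (cmod (g v))\<^sup>2) summable_on UNIV"
    using assms unfolding square_summable_def
    by (intro summable_on_add summable_on_cmult_right)
  fix v
  have "(cmod (f v + g v))\<^sup>2 \<le> (cmod (f v) + cmod (g v))\<^sup>2"
    by (intro power_mono norm_triangle_ineq) auto
  also have "\<dots> \<le> 2 * (cmod (f v))\<^sup>2 + 2 * (cmod (g v))\<^sup>2"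
    using sum_squares_bound[of "cmod (f v)" "cmod (g v)"] by (simp add: power2_sum)
  finally show "(cmod (f v + g v))\<^sup>2 \<le> 2 * (cmod (f v))\<^sup>2 + 2 * (cmod (g v))\<^sup>2" .
qed auto

lemma square_summable_product:
  assumes "square_summable f" "square_summable g"
  shows "(\<lambda>v. f v * cnj (g v)) summable_on UNIV"
proof (rule abs_summable_summable, rule Infinite_Sum.abs_summable_on_comparison_test)
  have *: "(\<lambda>v. (cmod (f v))\<^sup>2 + (cmod (g v))\<^sup>2) summable_on UNIV"
    using assms unfolding square_summable_def by (intro summable_on_add)
  show "(\<lambda>v. norm ((cmod (f v))\<^sup>2 + (cmod (g v))\<^sup>2)) summable_on UNIV"
    using * by (simp add: abs_of_nonneg)
  fix v
  have "0 \<le> cmod (f v) * cmod (g v)" by simp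
  then have "cmod (f v) * cmod (g v) \<le> (cmod (f v))\<^sup>2 + (cmod (g v))\<^sup>2"
    using sum_squares_bound[of "cmod (f v)" "cmod (g v)"] by linarith
  then show "norm (f v * cnj (g v)) \<le> norm ((cmod (f v))\<^sup>2 + (cmod (g v))\<^sup>2)"
    by (simp add: norm_mult)
qed

typedef 'v ell2 = "{f :: 'v \<Rightarrow> complex. square_summable f}"
  morphisms ell2_fun Abs_ell2
  using square_summable_zero by blast

lemma square_summable_ell2_fun [simp]: "square_summable (ell2_fun f)"
  using ell2_fun by blast

lemma ell2_fun_Abs: "square_summable f \<Longrightarrow> ell2_fun (Abs_ell2 f) = f"
  by (simp add: Abs_ell2_inverse)

lemma ell2_eqI: "(\<And>v. ell2_fun f v = ell2_fun g v) \<Longrightarrow> f = g"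
  using ell2_fun_inject by blast

instantiation ell2 :: (type) real_inner
begin

definition "0 = Abs_ell2 (\<lambda>v. 0)"
definition "f + g = Abs_ell2 (\<lambda>v. ell2_fun f v + ell2_fun g v)"
definition "- f = Abs_ell2 (\<lambda>v. - ell2_fun f v)" for f :: "'a ell2"
definition "f - g = Abs_ell2 (\<lambda>v. ell2_fun f v - ell2_fun g v)"
definition "r *\<^sub>R f = Abs_ell2 (\<lambda>v. complex_of_real r * ell2_fun f v)"
definition "inner f g = Re (\<Sum>\<^sub>\<infinity>v. ell2_fun f v * cnj (ell2_fun g v))"
definition "norm f = sqrt (inner f f)" for f :: "'a ell2"
definition "sgn f = inverse (norm f) *\<^sub>R f" for f :: "'a ell2"
definition "dist f g = norm (f - g)" for f g :: "'a ell2"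
definition [code del]:
  "(uniformity :: ('a ell2 \<times> 'a ell2) filter) = (INF e\<in>{0<..}. principal {(x, y). dist x y < e})"
definition [code del]:
  "open U \<longleftrightarrow> (\<forall>x\<in>U. \<forall>\<^sub>F (x', y) in uniformity. x' = x \<longrightarrow> y \<in> U)" for U :: "'a ell2 set"

lemma ell2_fun_zero: "ell2_fun 0 = (\<lambda>v. 0)"
  by (simp add: zero_ell2_def ell2_fun_Abs square_summable_zero)

lemma ell2_fun_add: "ell2_fun (f + g) = (\<lambda>v. ell2_fun f v + ell2_fun g v)"
  by (simp add: plus_ell2_def ell2_fun_Abs square_summable_add)

lemma ell2_fun_uminus: "ell2_fun (- f) = (\<lambda>v. - ell2_fun f v)"
  using square_summable_scale[of "ell2_fun f" "-1"]
  by (simp add: uminus_ell2_def ell2_fun_Abs)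

lemma ell2_fun_diff: "ell2_fun (f - g) = (\<lambda>v. ell2_fun f v - ell2_fun g v)"
proof -
  have "square_summable (\<lambda>v. ell2_fun f v + ell2_fun (- g) v)"
    by (intro square_summable_add square_summable_ell2_fun)
  then show ?thesis by (simp add: minus_ell2_def ell2_fun_Abs ell2_fun_uminus)
qed

lemma ell2_fun_scaleR: "ell2_fun (r *\<^sub>R f) = (\<lambda>v. complex_of_real r * ell2_fun f v)"
  by (simp add: scaleR_ell2_def ell2_fun_Abs square_summable_scale)

lemma ell2_product_commute:
  "(\<Sum>\<^sub>\<infinity>v. ell2_fun f v * cnj (ell2_fun g v))
     = cnj (\<Sum>\<^sub>\<infinity>v. ell2_fun g v * cnj (ell2_fun f v))"
proof -
  have "(\<Sum>\<^sub>\<infinity>v. ell2_fun f v * cnj (ell2_fun g v))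
      = (\<Sum>\<^sub>\<infinity>v. cnj (ell2_fun g v * cnj (ell2_fun f v)))"
    by (intro infsum_cong) simp
  then show ?thesis by (simp only: infsum_cnj)
qed

lemma ell2_self_product:
  "(\<Sum>\<^sub>\<infinity>v. ell2_fun f v * cnj (ell2_fun f v))
     = complex_of_real (\<Sum>\<^sub>\<infinity>v. (cmod (ell2_fun f v))\<^sup>2)"
proof -
  have "((\<lambda>v. (cmod (ell2_fun f v))\<^sup>2) has_sum (\<Sum>\<^sub>\<infinity>v. (cmod (ell2_fun f v))\<^sup>2)) UNIV"
    using square_summable_ell2_fun[of f] unfolding square_summable_def by simp
  then have "((\<lambda>v. complex_of_real ((cmod (ell2_fun f v))\<^sup>2)) has_sum
      complex_of_real (\<Sum>\<^sub>\<infinity>v. (cmod (ell2_fun f v))\<^sup>2)) UNIV"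
    by (rule has_sum_of_real)
  then show ?thesis
    by (simp add: infsumI flip: complex_norm_square)
qed

lemma inner_ell2_self: "inner f f = (\<Sum>\<^sub>\<infinity>v. (cmod (ell2_fun f v))\<^sup>2)" for f :: "'a ell2"
  unfolding inner_ell2_def ell2_self_product by simp

instance
proof
  fix x y z :: "'a ell2" and r s :: real
  show "x + y + z = x + (y + z)" "x + y = y + x" "0 + x = x" "- x + x = 0" "x - y = x + - y"
    "r *\<^sub>R (x + y) = r *\<^sub>R x + r *\<^sub>R y" "(r + s) *\<^sub>R x = r *\<^sub>R x + s *\<^sub>R x"
    "r *\<^sub>R s *\<^sub>R x = (r * s) *\<^sub>R x" "1 *\<^sub>R x = x"
    by (auto intro!: ell2_eqI simp: ell2_fun_zero ell2_fun_add ell2_fun_uminus ell2_fun_diff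
        ell2_fun_scaleR algebra_simps)
  show "inner x y = inner y x"
    unfolding inner_ell2_def by (subst ell2_product_commute) simp
  show "inner (x + y) z = inner x z + inner y z"
    by (simp add: inner_ell2_def ell2_fun_add distrib_right infsum_add square_summable_product)
  show "inner (r *\<^sub>R x) y = r * inner x y"
    by (simp add: inner_ell2_def ell2_fun_scaleR mult.assoc infsum_cmult_right')
  show "0 \<le> inner x x"
    by (simp add: inner_ell2_self infsum_nonneg)
  show "inner x x = 0 \<longleftrightarrow> x = 0"
  proof
    assume "inner x x = 0"
    then have "(\<Sum>\<^sub>\<infinity>v. (cmod (ell2_fun x v))\<^sup>2) = 0"
      by (simp add: inner_ell2_self)
    moreover have "(\<lambda>v. (cmod (ell2_fun x v))\<^sup>2) summable_on UNIV"
      using square_summable_ell2_fun[of x] unfolding square_summable_def .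
    ultimately have "(cmod (ell2_fun x v))\<^sup>2 = 0" for v
      by (intro nonneg_infsum_le_0D[of "\<lambda>v. (cmod (ell2_fun x v))\<^sup>2" UNIV]) auto
    then show "x = 0" by (intro ell2_eqI) (simp add: ell2_fun_zero)
  qed (simp add: inner_ell2_self ell2_fun_zero)
qed (rule norm_ell2_def sgn_ell2_def dist_ell2_def uniformity_ell2_def open_ell2_def)+

end

lemma norm_ell2_square: "(norm f)\<^sup>2 = (\<Sum>\<^sub>\<infinity>v. (cmod (ell2_fun f v))\<^sup>2)"
  by (simp add: power2_norm_eq_inner inner_ell2_self)

lemma sum_le_norm_ell2:
  assumes "finite F" shows "(\<Sum>v\<in>F. (cmod (ell2_fun f v))\<^sup>2) \<le> (norm f)\<^sup>2"
  unfolding norm_ell2_square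
  using square_summable_ell2_fun[of f] assms unfolding square_summable_def
  by (intro finite_sum_le_infsum) auto

lemma cmod_ell2_fun_le_norm: "cmod (ell2_fun f v) \<le> norm f"
  using sum_le_norm_ell2[of "{v}" f] by (simp add: power2_le_iff_abs_le)

instance ell2 :: (type) complete_space
proof
  fix X :: "nat \<Rightarrow> 'a ell2"
  assume X: "Cauchy X"
  have "convergent (\<lambda>n. ell2_fun (X n) v)" for v
  proof (rule Cauchy_convergent, rule metric_CauchyI)
    fix e :: real assume "0 < e"
    then obtain N where N: "\<And>m n. m \<ge> N \<Longrightarrow> n \<ge> N \<Longrightarrow> dist (X m) (X n) < e"
      using X unfolding Cauchy_def by blast
    have "dist (ell2_fun (X m) v) (ell2_fun (X n) v) < e" if "m \<ge> N" "n \<ge> N" for m n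
      using cmod_ell2_fun_le_norm[of "X m - X n" v] N[OF that]
      by (simp add: dist_norm ell2_fun_diff)
    then show "\<exists>N. \<forall>m\<ge>N. \<forall>n\<ge>N. dist (ell2_fun (X m) v) (ell2_fun (X n) v) < e" by blast
  qed
  then obtain f where f: "\<And>v. (\<lambda>n. ell2_fun (X n) v) \<longlonglongrightarrow> f v"
    unfolding convergent_def by metis
  have bound: "\<exists>N. \<forall>n\<ge>N. \<forall>F. finite F \<longrightarrow> (\<Sum>v\<in>F. (cmod (ell2_fun (X n) v - f v))\<^sup>2) \<le> e\<^sup>2"
    if "0 < e" for e :: real
  proof -
    obtain N where N: "\<And>m n. m \<ge> N \<Longrightarrow> n \<ge> N \<Longrightarrow> dist (X m) (X n) < e"
      using X \<open>0 < e\<close> unfolding Cauchy_def by blast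
    have "(\<Sum>v\<in>F. (cmod (ell2_fun (X n) v - f v))\<^sup>2) \<le> e\<^sup>2" if n: "n \<ge> N" and "finite F" for n F
    proof (rule LIMSEQ_le_const2)
      show "(\<lambda>m. \<Sum>v\<in>F. (cmod (ell2_fun (X n) v - ell2_fun (X m) v))\<^sup>2)
          \<longlonglongrightarrow> (\<Sum>v\<in>F. (cmod (ell2_fun (X n) v - f v))\<^sup>2)"
        by (intro tendsto_intros f)
      have "(\<Sum>v\<in>F. (cmod (ell2_fun (X n) v - ell2_fun (X m) v))\<^sup>2) \<le> e\<^sup>2" if "m \<ge> N" for m
      proof -
        have "(\<Sum>v\<in>F. (cmod (ell2_fun (X n) v - ell2_fun (X m) v))\<^sup>2) \<le> (norm (X n - X m))\<^sup>2"
          using sum_le_norm_ell2[OF \<open>finite F\<close>, of "X n - X m"] by (simp add: ell2_fun_diff)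
        also have "\<dots> \<le> e\<^sup>2"
          using N[OF n that] by (intro power_mono) (auto simp: dist_norm)
        finally show ?thesis .
      qed
      then show "\<exists>N. \<forall>m\<ge>N. (\<Sum>v\<in>F. (cmod (ell2_fun (X n) v - ell2_fun (X m) v))\<^sup>2) \<le> e\<^sup>2"
        by blast
    qed
    then show ?thesis by blast
  qed
  have diff: "square_summable (\<lambda>v. ell2_fun (X n) v - f v)"
    if "\<forall>F. finite F \<longrightarrow> (\<Sum>v\<in>F. (cmod (ell2_fun (X n) v - f v))\<^sup>2) \<le> b" for n b
    unfolding square_summable_def using that
    by (intro nonneg_bdd_above_summable_on bdd_aboveI[of _ b]) auto
  obtain N where "\<forall>F. finite F \<longrightarrow> (\<Sum>v\<in>F. (cmod (ell2_fun (X N) v - f v))\<^sup>2) \<le> 1\<^sup>2"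
    using bound[of 1] by auto
  from square_summable_add[OF square_summable_ell2_fun[of "X N"]
      square_summable_scale[OF diff[OF this], of "-1"]]
  have "square_summable f" by simp
  then have fun_f: "ell2_fun (Abs_ell2 f) = f" by (rule ell2_fun_Abs)
  have "X \<longlonglongrightarrow> Abs_ell2 f"
  proof (rule metric_LIMSEQ_I)
    fix e :: real assume "0 < e"
    then obtain N where
      N: "\<forall>n\<ge>N. \<forall>F. finite F \<longrightarrow> (\<Sum>v\<in>F. (cmod (ell2_fun (X n) v - f v))\<^sup>2) \<le> (e / 2)\<^sup>2"
      using bound[of "e / 2"] by auto
    have "dist (X n) (Abs_ell2 f) < e" if "n \<ge> N" for n
    proof -
      have n: "\<forall>F. finite F \<longrightarrow> (\<Sum>v\<in>F. (cmod (ell2_fun (X n) v - f v))\<^sup>2) \<le> (e / 2)\<^sup>2"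
        using N that by blast
      have "(norm (X n - Abs_ell2 f))\<^sup>2 = (\<Sum>\<^sub>\<infinity>v. (cmod (ell2_fun (X n) v - f v))\<^sup>2)"
        by (simp add: norm_ell2_square ell2_fun_diff fun_f)
      also have "\<dots> \<le> (e / 2)\<^sup>2"
        using diff[OF n] n unfolding square_summable_def by (intro infsum_le_finite_sums) auto
      finally have "norm (X n - Abs_ell2 f) \<le> e / 2"
        by (rule power2_le_imp_le) (use \<open>0 < e\<close> in simp)
      with \<open>0 < e\<close> show ?thesis by (simp add: dist_norm)
    qed
    then show "\<exists>N. \<forall>n\<ge>N. dist (X n) (Abs_ell2 f) < e" by blast
  qed
  then show "convergent X" by (auto simp: convergent_def)
qed

instantiation ell2 :: (type) complex_hilbert
begin

definition "c *\<^sub>C f = Abs_ell2 (\<lambda>v. c * ell2_fun f v)"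
definition "cinner f g = (\<Sum>\<^sub>\<infinity>v. ell2_fun f v * cnj (ell2_fun g v))"

lemma ell2_fun_scaleC: "ell2_fun (c *\<^sub>C f) = (\<lambda>v. c * ell2_fun f v)"
  by (simp add: scaleC_ell2_def ell2_fun_Abs square_summable_scale)

instance
proof
  fix x y z :: "'a ell2" and c d :: complex and r :: real
  show "c *\<^sub>C (x + y) = c *\<^sub>C x + c *\<^sub>C y" "(c + d) *\<^sub>C x = c *\<^sub>C x + d *\<^sub>C x"
    "c *\<^sub>C d *\<^sub>C x = (c * d) *\<^sub>C x" "complex_of_real r *\<^sub>C x = r *\<^sub>R x"
    by (auto intro!: ell2_eqI simp: ell2_fun_add ell2_fun_scaleR ell2_fun_scaleC algebra_simps)
  show "cinner x y = cnj (cinner y x)"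
    unfolding cinner_ell2_def by (rule ell2_product_commute)
  show "cinner (x + y) z = cinner x z + cinner y z"
    by (simp add: cinner_ell2_def ell2_fun_add distrib_right infsum_add square_summable_product)
  show "cinner (c *\<^sub>C x) y = c * cinner x y"
    by (simp add: cinner_ell2_def ell2_fun_scaleC mult.assoc infsum_cmult_right')
  show "Re (cinner x y) = inner x y"
    by (simp add: cinner_ell2_def inner_ell2_def)
qed

end

section \<open>Directed trees and weighted shifts\<close>

text \<open>
  The vertex set is the whole type \<open>'v\<close>, and \<open>(u, v) \<in> E\<close> says that \<open>u\<close> is the parent
  of \<open>v\<close>. Connectedness is that of the underlying undirected graph.
\<close>

definition directed_tree :: "('v \<times> 'v) set \<Rightarrow> bool" where
  "directed_tree E \<longleftrightarrow> acyclic E \<and> (\<forall>u v. (u, v) \<in> (E \<union> E\<inverse>)\<^sup>*)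
     \<and> (\<forall>u u' v. (u, v) \<in> E \<and> (u', v) \<in> E \<longrightarrow> u = u')"

definition is_root :: "('v \<times> 'v) set \<Rightarrow> 'v \<Rightarrow> bool" where
  "is_root E v \<longleftrightarrow> (\<nexists>u. (u, v) \<in> E)"

definition rooted_directed_tree :: "('v \<times> 'v) set \<Rightarrow> bool" where
  "rooted_directed_tree E \<longleftrightarrow> directed_tree E \<and> (\<exists>!v. is_root E v)"

definition par :: "('v \<times> 'v) set \<Rightarrow> 'v \<Rightarrow> 'v" where
  "par E v = (THE u. (u, v) \<in> E)"

definition leafless :: "('v \<times> 'v) set \<Rightarrow> bool" where
  "leafless E \<longleftrightarrow> (\<forall>u. \<exists>v. (u, v) \<in> E)"

definition shift_fun :: "('v \<times> 'v) set \<Rightarrow> ('v \<Rightarrow> real) \<Rightarrow> ('v \<Rightarrow> complex) \<Rightarrow> 'v \<Rightarrow> complex" where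
  "shift_fun E w f v = (if is_root E v then 0 else complex_of_real (w v) * f (par E v))"

definition shift_domain :: "('v \<times> 'v) set \<Rightarrow> ('v \<Rightarrow> real) \<Rightarrow> 'v ell2 set" where
  "shift_domain E w = {f. square_summable (shift_fun E w (ell2_fun f))}"

text \<open>
  Only the values on \<^const>\<open>shift_domain\<close> are meaningful; elsewhere the totalised function
  is set to \<open>0\<close>.
\<close>

definition weighted_shift :: "('v \<times> 'v) set \<Rightarrow> ('v \<Rightarrow> real) \<Rightarrow> 'v ell2 \<Rightarrow> 'v ell2" where
  "weighted_shift E w f =
     (if f \<in> shift_domain E w then Abs_ell2 (shift_fun E w (ell2_fun f)) else 0)"

end

theory Submission
  imports Defs "HOL-Complex_Analysis.Laurent_Convergence"
begin

text \<open>
  Let \<open>L\<close> be a bounded left inverse of \<open>S\<close> and \<open>P = I - S L\<close>, so that \<open>P S = 0\<close>. For small \<open>\<mu>\<close> the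
  functionals \<open>T\<^sub>y h = (\<Sum>j. \<mu> ^ j * \<langle>P (L ^ j) h, y\<rangle>)\<close> satisfy \<open>T\<^sub>y (S h) = \<mu> * T\<^sub>y h\<close>, hence all linear
  combinations of them have kernels in \<open>Lat (W_alg S)\<close>. If \<open>A\<close> preserves these kernels, then
  \<open>T\<^sub>y (A h) = \<phi> \<mu> * T\<^sub>y h\<close> with \<open>\<phi>\<close> independent of \<open>y\<close> and \<open>h\<close>, and \<open>\<phi> \<mu> = (\<Sum>i. a i * \<mu> ^ i)\<close> is analytic.
  Comparing coefficients shows that \<open>A h\<close> agrees with \<open>\<Sum>i<n. a i * (S ^ i) h\<close> up to the range of \<open>S ^ n\<close>.

  For a weighted shift on a rooted tree, elements of the range of \<open>S ^ n\<close> vanish at depths below \<open>n\<close>,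
  so \<open>A\<close> is the formal series \<open>\<Sum>i. a i * S ^ i\<close>. Its Fejer means are averages of the compressions of
  \<open>A\<close> to \<open>N\<close> consecutive generations of the tree; they are therefore bounded by the norm of \<open>A\<close>, and these
  polynomials in \<open>S\<close> converge to \<open>A\<close> weakly.
\<close>

section \<open>Complex Hilbert spaces\<close>

lemma cinner_add_right: "cinner x (y + z) = cinner x y + cinner x z"
  for x y z :: "'a::complex_hilbert"
  by (metis cinner_add_left cinner_commute complex_cnj_add)

lemma cinner_scaleC_right: "cinner x (c *\<^sub>C y) = cnj c * cinner x y"
  for x y :: "'a::complex_hilbert"
  by (metis cinner_scaleC_left cinner_commute complex_cnj_mult)

lemma scaleC_zero_left [simp]: "0 *\<^sub>C x = 0" for x :: "'a::complex_hilbert"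
  using scaleC_of_real[of 0 x] by simp

lemma scaleC_zero_right [simp]: "c *\<^sub>C (0 :: 'a::complex_hilbert) = 0"
  by (metis scaleC_zero_left scaleC_scaleC mult_zero_right)

lemma scaleC_minus_one: "(-1) *\<^sub>C x = - x" for x :: "'a::complex_hilbert"
  using scaleC_of_real[of "-1" x] by simp

lemma cinner_minus_left: "cinner (- x) y = - cinner x y" for x y :: "'a::complex_hilbert"
  by (metis cinner_scaleC_left scaleC_minus_one mult_minus1)

lemma cinner_diff_left: "cinner (x - y) z = cinner x z - cinner y z"
  for x y z :: "'a::complex_hilbert"
  by (metis add_uminus_conv_diff cinner_add_left cinner_minus_left)

lemma scaleC_diff_right: "c *\<^sub>C (x - y) = c *\<^sub>C x - c *\<^sub>C y"
  for x y :: "'a::complex_hilbert"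
  by (metis add_diff_cancel_right' diff_add_cancel scaleC_add_right)

lemma cinner_zero_left [simp]: "cinner 0 y = 0" for y :: "'a::complex_hilbert"
  using cinner_scaleC_left[of 0 0 y] by simp

lemma cinner_sum_left: "cinner (\<Sum>i\<in>I. f i) y = (\<Sum>i\<in>I. cinner (f i) y)"
  for y :: "'a::complex_hilbert"
  by (induction I rule: infinite_finite_induct) (auto simp: cinner_add_left)

lemma cinner_self: "cinner x x = complex_of_real ((norm x)\<^sup>2)" for x :: "'a::complex_hilbert"
proof (rule complex_eqI)
  show "Re (cinner x x) = Re (complex_of_real ((norm x)\<^sup>2))"
    by (simp add: Re_cinner power2_norm_eq_inner)
  have "Im (cinner x x) = - Im (cinner x x)"
    by (subst cinner_commute) simp
  then show "Im (cinner x x) = Im (complex_of_real ((norm x)\<^sup>2))"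
    by simp
qed

lemma norm_scaleC: "norm (c *\<^sub>C x) = cmod c * norm x" for x :: "'a::complex_hilbert"
proof -
  have "complex_of_real ((norm (c *\<^sub>C x))\<^sup>2) = c * cnj c * complex_of_real ((norm x)\<^sup>2)"
    unfolding cinner_self[symmetric] by (simp add: cinner_scaleC_left cinner_scaleC_right)
  also have "\<dots> = complex_of_real ((cmod c * norm x)\<^sup>2)"
    by (simp add: power_mult_distrib flip: complex_norm_square)
  finally show ?thesis
    by (simp only: of_real_eq_iff power2_eq_iff_nonneg norm_ge_zero mult_nonneg_nonneg)
qed

lemma cmod_cinner_le: "cmod (cinner x y) \<le> norm x * norm y" for x y :: "'a::complex_hilbert"
proof (cases "cinner x y = 0")
  case False
  \<comment> \<open>The phase \<open>u\<close> makes \<open>u * cinner x y\<close> real and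
    positive, so the real Cauchy-Schwarz inequality applies to \<open>u *\<^sub>C x\<close>.\<close>
  define u where "u = cnj (cinner x y) / cmod (cinner x y)"
  have u: "cmod u = 1" "u * cinner x y = cmod (cinner x y)"
    using False by (simp_all add: u_def norm_divide mult.commute flip: complex_norm_square)
      (simp add: power2_eq_square)
  have "cmod (cinner x y) = Re (cinner (u *\<^sub>C x) y)"
    by (simp add: cinner_scaleC_left u)
  also have "\<dots> \<le> norm (u *\<^sub>C x) * norm y"
    unfolding Re_cinner by (rule norm_cauchy_schwarz)
  finally show ?thesis
    by (simp add: norm_scaleC u)
qed simp

lemma cinner_eqI: "(\<And>z. cinner x z = cinner y z) \<Longrightarrow> x = y" for x y :: "'a::complex_hilbert"
  using cinner_self[of "x - y"] cinner_diff_left[of x y] by simp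

text \<open>A nonzero \<open>f\<close> attains its norm on the unit sphere: the parallelogram law
  makes a maximising sequence Cauchy. The maximiser is orthogonal to the kernel of \<open>f\<close>,
  so it represents \<open>f\<close> up to the factor \<open>onorm f\<close>.\<close>

lemma riesz_real:
  fixes f :: "'a::{real_inner,complete_space} \<Rightarrow> real"
  assumes f: "bounded_linear f"
  obtains g where "\<And>x. f x = inner x g"
proof (cases "\<forall>x. f x = 0")
  case True
  then show ?thesis using that[of 0] by simp
next
  case False
  interpret bounded_linear f by fact
  define K where "K = onorm f"
  have K: "K > 0"
    using False f onorm_pos_lt unfolding K_def by blast
  have le: "f x \<le> K * norm x" for x
    using onorm[OF f, of x] unfolding K_def by simp
  have "\<exists>y. norm y = 1 \<and> K * (1 - 1 / Suc n) \<le> f y" for n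
  proof -
    have "K * (1 - 1 / Suc n) < K" using K by (simp add: field_simps)
    moreover have "0 \<le> K * (1 - 1 / Suc n)" using K by (simp add: field_simps)
    ultimately obtain x where x: "\<bar>f x\<bar> > K * (1 - 1 / Suc n) * norm x"
      using onorm_bound[of "K * (1 - 1 / Suc n)" f] unfolding K_def[symmetric]
      by (metis linorder_not_le real_norm_def)
    then have "x \<noteq> 0" using zero by auto
    define y where "y = (sgn (f x) / norm x) *\<^sub>R x"
    have nz: "f x \<noteq> 0" using x \<open>0 \<le> K * (1 - 1 / Suc n)\<close>
      by (smt (verit) mult_nonneg_nonneg norm_ge_zero)
    have "norm y = 1"
      using \<open>x \<noteq> 0\<close> nz by (auto simp: y_def sgn_if)
    moreover have "f y = \<bar>f x\<bar> / norm x"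
      by (simp add: y_def scaleR abs_sgn mult.commute)
    moreover have "K * (1 - 1 / Suc n) \<le> \<bar>f x\<bar> / norm x"
      using less_imp_le[OF x] \<open>x \<noteq> 0\<close> by (subst pos_le_divide_eq) auto
    ultimately show ?thesis by metis
  qed
  then obtain y where y: "\<And>n. norm (y n) = 1" "\<And>n. K * (1 - 1 / Suc n) \<le> f (y n)"
    by metis
  \<comment> \<open>Near-maximality forces \<open>norm (y m + y n)\<close> close to 2, and the
    parallelogram identity then makes the difference small.\<close>
  have close: "(norm (y m - y n))\<^sup>2 \<le> 8 / Suc N" if "m \<ge> N" "n \<ge> N" for m n N
  proof -
    have "K * (1 - 1 / Suc N) \<le> K * (1 - 1 / Suc k)" if "k \<ge> N" for k
      using that K by (intro mult_left_mono) (auto simp: frac_le)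
    from add_mono[OF order_trans[OF this y(2)] order_trans[OF this y(2)], OF that]
    have "K * (2 * (1 - 1 / Suc N)) \<le> f (y m + y n)"
      unfolding add by (simp only: mult_2 distrib_left)
    also have "\<dots> \<le> K * norm (y m + y n)" by (rule le)
    finally have "2 * (1 - 1 / Suc N) \<le> norm (y m + y n)" using K by simp
    then have "(2 * (1 - 1 / Suc N))\<^sup>2 \<le> (norm (y m + y n))\<^sup>2"
      by (intro power_mono) (auto simp: field_simps)
    moreover have "(norm (y m + y n))\<^sup>2 + (norm (y m - y n))\<^sup>2 = 4"
      using y(1)[of m] y(1)[of n]
      by (simp add: power2_norm_eq_inner norm_eq_1 inner_add inner_diff inner_commute)
    moreover have "4 - (2 * (1 - 1 / Suc N))\<^sup>2 \<le> 8 / Suc N"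
      by (simp add: power2_eq_square algebra_simps)
    ultimately show ?thesis by linarith
  qed
  have "Cauchy y"
  proof (rule CauchyI)
    fix e :: real assume "0 < e"
    obtain N :: nat where "8 / e\<^sup>2 < N" using reals_Archimedean2 by blast
    then have "8 / Suc N < e\<^sup>2"
      using \<open>0 < e\<close> by (simp add: field_simps) (smt (verit) zero_le_power2)
    then have "norm (y m - y n) < e" if "m \<ge> N" "n \<ge> N" for m n
      using close[OF that] \<open>0 < e\<close> by (intro power_less_imp_less_base[of _ 2 e]) auto
    then show "\<exists>M. \<forall>m\<ge>M. \<forall>n\<ge>M. norm (y m - y n) < e" by blast
  qed
  then obtain x where x: "y \<longlonglongrightarrow> x"
    using Cauchy_convergent convergent_def by blast
  have "(\<lambda>n. norm (y n)) \<longlonglongrightarrow> norm x" using x by (rule tendsto_norm)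
  then have norm_x: "norm x = 1" by (simp add: y(1) LIMSEQ_const_iff)
  have "K \<le> f x"
  proof (rule LIMSEQ_le)
    show "(\<lambda>n. f (y n)) \<longlonglongrightarrow> f x" using x by (rule tendsto)
    show "(\<lambda>n. K * (1 - 1 / Suc n)) \<longlonglongrightarrow> K"
      by real_asymp
  qed (use y in auto)
  then have fx: "f x = K" using le[of x] norm_x by simp
  have orth: "inner x h = 0" if "f h = 0" for h
  proof (cases "h = 0")
    case False
    \<comment> \<open>This \<open>t\<close> minimises \<open>norm (x + t *\<^sub>R h)\<close>. As
      \<open>f\<close> takes the value \<open>K\<close> at that vector, the minimum is still at
      least 1.\<close>
    define t where "t = - inner x h / inner h h"
    have "K * 1 \<le> K * norm (x + t *\<^sub>R h)"
      using le[of "x + t *\<^sub>R h"] by (simp add: add scaleR fx that)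
    then have "1 \<le> norm (x + t *\<^sub>R h)" using K by simp
    then have "1 \<le> (norm (x + t *\<^sub>R h))\<^sup>2" by (simp add: one_le_power)
    also have "\<dots> = 1 + 2 * t * inner x h + t * t * inner h h"
      using norm_x by (simp add: power2_norm_eq_inner norm_eq_1 inner_add inner_commute algebra_simps)
    also have "\<dots> = 1 - (inner x h)\<^sup>2 / inner h h"
      using False by (simp add: t_def power2_eq_square field_simps)
    finally have "(inner x h)\<^sup>2 / inner h h \<le> 0" by simp
    then show ?thesis using False
      by (simp add: divide_le_0_iff inner_gt_zero_iff not_le)
        (metis inner_gt_zero_iff not_le)
  qed simp
  have "f h = inner h (K *\<^sub>R x)" for h
  proof -
    have "f (h - (f h / K) *\<^sub>R x) = 0" using K by (simp add: diff scaleR fx)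
    from orth[OF this] have "inner x h = f h / K"
      using norm_x by (simp add: inner_diff norm_eq_1)
    then show ?thesis using K by (simp add: inner_commute)
  qed
  then show ?thesis by (rule that)
qed

text \<open>The real version represents the real part; evaluation at \<open>\<i> *\<^sub>C x\<close>
  recovers the imaginary part.\<close>

lemma riesz:
  fixes T :: "'a::complex_hilbert \<Rightarrow> complex"
  assumes T: "bounded_linear T" and scale: "\<And>c x. T (c *\<^sub>C x) = c * T x"
  obtains g where "\<And>x. T x = cinner x g"
proof -
  have "bounded_linear (\<lambda>x. Re (T x))"
    by (rule bounded_linear_compose[OF bounded_linear_Re T])
  then obtain g where g: "\<And>x. Re (T x) = inner x g" using riesz_real by blast
  have "T x = cinner x g" for x
  proof (rule complex_eqI)
    show "Re (T x) = Re (cinner x g)" by (simp add: g Re_cinner)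
    have "Re (T (\<i> *\<^sub>C x)) = Re (cinner (\<i> *\<^sub>C x) g)" by (simp only: g Re_cinner)
    then show "Im (T x) = Im (cinner x g)" by (simp add: scale cinner_scaleC_left)
  qed
  then show ?thesis by (rule that)
qed

section \<open>The weak operator topology\<close>

lemma bounded_clinearI:
  assumes "bounded_linear A" "\<And>c x. A (c *\<^sub>C x) = c *\<^sub>C A x"
  shows "A \<in> bounded_operators"
  using assms by (simp add: bounded_operators_def bounded_clinear_def)

lemma bounded_operatorsD:
  assumes "A \<in> bounded_operators"
  shows "bounded_linear A" "A (c *\<^sub>C x) = c *\<^sub>C A x"
  using assms by (simp_all add: bounded_operators_def bounded_clinear_def)

lemma bounded_linear_scaleC: "bounded_linear (\<lambda>x :: 'a::complex_hilbert. c *\<^sub>C x)"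
proof (rule bounded_linear_intro[where K="cmod c"])
  show "c *\<^sub>C (r *\<^sub>R x) = r *\<^sub>R (c *\<^sub>C x)" for r and x :: 'a
    by (simp add: scaleC_scaleC mult.commute flip: scaleC_of_real)
qed (auto simp: scaleC_add_right norm_scaleC)

lemma operator_subalgebra_bounded_operators:
  "operator_subalgebra (bounded_operators :: ('a::complex_hilbert \<Rightarrow> 'a) set)"
  unfolding operator_subalgebra_def
proof (intro conjI ballI allI)
  fix A B :: "'a \<Rightarrow> 'a" and c
  assume A: "A \<in> bounded_operators"
  show "(\<lambda>x. c *\<^sub>C A x) \<in> bounded_operators"
    by (intro bounded_clinearI bounded_linear_compose[OF bounded_linear_scaleC] bounded_operatorsD(1)[OF A])
      (simp add: bounded_operatorsD[OF A] scaleC_scaleC mult.commute)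
  assume B: "B \<in> bounded_operators"
  show "(\<lambda>x. A x + B x) \<in> bounded_operators"
    by (intro bounded_clinearI bounded_linear_add bounded_operatorsD(1)[OF A] bounded_operatorsD(1)[OF B])
      (simp add: bounded_operatorsD[OF A] bounded_operatorsD[OF B] scaleC_add_right)
  show "A \<circ> B \<in> bounded_operators"
    unfolding comp_def
    by (intro bounded_clinearI bounded_linear_compose[OF bounded_operatorsD(1)[OF A]]
          bounded_operatorsD(1)[OF B])
      (simp add: bounded_operatorsD[OF A] bounded_operatorsD[OF B])
qed (auto intro: bounded_clinearI bounded_linear_zero)

lemma id_bounded_operator: "id \<in> bounded_operators"
  by (auto intro!: bounded_clinearI bounded_linear_ident simp: id_def)

lemma topspace_weak_operator_topology: "topspace weak_operator_topology = bounded_operators"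
  by (simp add: weak_operator_topology_def topspace_pullback_topology)

text \<open>The complement is the preimage of a union of sets \<open>{f. f q \<noteq> 0}\<close>,
  which are open for pointwise convergence.\<close>

lemma closedin_WOT_zero_coefficients:
  "closedin weak_operator_topology {A \<in> bounded_operators. \<forall>(x, y)\<in>R. cinner (A x) y = 0}"
proof -
  have "open (\<Union>q\<in>R. {f :: 'a \<times> 'a \<Rightarrow> complex. f q \<noteq> 0})"
    by (intro open_UN ballI open_Collect_neq continuous_on_product_coordinates continuous_on_const)
  moreover have "bounded_operators - {A \<in> bounded_operators. \<forall>(x, y)\<in>R. cinner (A x) y = 0}
      = (\<lambda>A (x, y). cinner (A x) y) -` (\<Union>q\<in>R. {f. f q \<noteq> 0}) \<inter> bounded_operators"
    by force
  ultimately show ?thesis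
    unfolding closedin_def topspace_weak_operator_topology
    unfolding weak_operator_topology_def openin_pullback_topology
    by (auto simp only: open_openin[symmetric])
qed

lemma closedin_WOT_limit:
  assumes W: "closedin weak_operator_topology W" and X: "\<And>n. X n \<in> W" and A: "A \<in> bounded_operators"
    and lim: "\<And>x y. (\<lambda>n::nat. cinner (X n x) y) \<longlonglongrightarrow> cinner (A x) y"
  shows "A \<in> W"
proof (rule limitin_closedin[OF _ W])
  let ?F = "\<lambda>A (x, y). cinner (A x) y"
  have "limitin (product_topology (\<lambda>_. euclidean) UNIV) (\<lambda>n. ?F (X n)) (?F A) sequentially"
    unfolding limitin_componentwise using lim by auto
  then have F: "(\<lambda>n. ?F (X n)) \<longlonglongrightarrow> ?F A"
    by (simp add: euclidean_product_topology)
  have "X n \<in> bounded_operators" for n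
    using closedin_subset[OF W] X by (auto simp: topspace_weak_operator_topology)
  then show "limitin weak_operator_topology X A sequentially"
    unfolding limitin_def topspace_weak_operator_topology
    unfolding weak_operator_topology_def openin_pullback_topology
    using A topological_tendstoD[OF F] by (auto simp: open_openin[symmetric])
qed (use X in auto)

lemma W_alg_subset:
  assumes "operator_subalgebra W" "A \<in> W" "id \<in> W" "closedin weak_operator_topology W"
  shows "W_alg A \<subseteq> W"
  using assms unfolding W_alg_def by blast

lemma W_alg_bounded: "A \<in> bounded_operators \<Longrightarrow> W_alg A \<subseteq> bounded_operators"
  using closedin_topspace[of weak_operator_topology]
  by (intro W_alg_subset operator_subalgebra_bounded_operators id_bounded_operator)
    (simp_all add: topspace_weak_operator_topology)

lemma W_alg_subset_Alg_Lat: "A \<in> bounded_operators \<Longrightarrow> W_alg A \<subseteq> Alg (Lat (W_alg A))"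
  using W_alg_bounded unfolding Alg_def Lat_def by blast

text \<open>The operators preserving the kernel of \<open>T\<close> form an algebra containing
  \<open>S\<close> and \<open>id\<close>. Riesz expresses preservation by the vanishing of matrix
  coefficients against a fixed vector, so this algebra is weakly closed and contains
  \<open>W_alg S\<close>; hence the kernel belongs to the lattice.\<close>

lemma Alg_Lat_eigenfunctional:
  assumes S: "S \<in> bounded_operators" and T: "bounded_linear T"
    and scale: "\<And>c x. T (c *\<^sub>C x) = c * T x" and eig: "\<And>x. T (S x) = \<mu> * T x"
    and A: "A \<in> Alg (Lat (W_alg S))" and h: "T h = 0"
  shows "T (A h) = 0"
proof -
  obtain g where g: "\<And>x. T x = cinner x g"
    using riesz[OF T scale] by blast
  interpret T: bounded_linear T by fact
  define W where "W = {B \<in> bounded_operators. \<forall>(x, y)\<in>{x. T x = 0} \<times> {g}. cinner (B x) y = 0}"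
  have W: "B \<in> W \<longleftrightarrow> B \<in> bounded_operators \<and> (\<forall>x. T x = 0 \<longrightarrow> T (B x) = 0)" for B
    by (auto simp: W_def g)
  have "operator_subalgebra W"
    using operator_subalgebra_bounded_operators unfolding operator_subalgebra_def
    by (auto simp: W T.add T.zero scale)
  then have "W_alg S \<subseteq> W"
    using S by (intro W_alg_subset)
      (auto simp: W eig id_bounded_operator, simp only: W_def closedin_WOT_zero_coefficients)
  moreover have "closed_csubspace {x. T x = 0}"
    unfolding closed_csubspace_def
    by (auto simp: T.add T.zero scale
        intro!: closed_Collect_eq linear_continuous_on T continuous_on_const)
  ultimately have M: "{x. T x = 0} \<in> Lat (W_alg S)"
    unfolding Lat_def using W by auto
  have "\<forall>M\<in>Lat (W_alg S). A ` M \<subseteq> M" using A by (simp add: Alg_def)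
  from bspec[OF this M] h show ?thesis by (simp add: image_subset_iff)
qed

section \<open>Operators with a bounded left inverse\<close>

text \<open>The \<open>j\<close>-th coefficient \<open>P (L ^ j) h\<close> of the analytic function representing \<open>h\<close>.\<close>

definition moment :: "('a::complex_hilbert \<Rightarrow> 'a) \<Rightarrow> ('a \<Rightarrow> 'a) \<Rightarrow> nat \<Rightarrow> 'a \<Rightarrow> 'a" where
  "moment S L j h = (L ^^ j) h - S ((L ^^ Suc j) h)"

context
  fixes S L :: "'a::complex_hilbert \<Rightarrow> 'a"
  assumes S: "S \<in> bounded_operators" and L: "L \<in> bounded_operators" and LS: "\<And>x. L (S x) = x"
begin

interpretation S: bounded_linear S by (rule bounded_operatorsD[OF S])
interpretation L: bounded_linear L by (rule bounded_operatorsD[OF L])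

section \<open>Moments as Taylor coefficients\<close>

lemma moment_Suc_shift: "moment S L (Suc j) (S h) = moment S L j h"
  by (simp add: moment_def LS funpow_swap1)

lemma moment_0_shift: "moment S L 0 (S h) = 0"
  by (simp add: moment_def LS)

lemma moment_add: "moment S L j (x + y) = moment S L j x + moment S L j y"
proof -
  have "(L ^^ k) (x + y) = (L ^^ k) x + (L ^^ k) y" for k
    by (induction k) (simp_all add: L.add)
  then show ?thesis unfolding moment_def by (simp add: L.add S.add)
qed

lemma moment_scaleC: "moment S L j (c *\<^sub>C x) = c *\<^sub>C moment S L j x"
proof -
  have "(L ^^ k) (c *\<^sub>C x) = c *\<^sub>C (L ^^ k) x" for k
    by (induction k) (simp_all add: bounded_operatorsD[OF L])
  then show ?thesis
    unfolding moment_def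
    by (simp add: bounded_operatorsD[OF L] bounded_operatorsD[OF S] scaleC_diff_right)
qed

lemma moment_zero: "moment S L j 0 = 0"
  using moment_scaleC[of j 0 0] by simp

lemma moment_diff: "moment S L j (x - y) = moment S L j x - moment S L j y"
  using moment_add[of j "x - y" y] by simp

lemma moment_sum: "moment S L j (\<Sum>i\<in>I. f i) = (\<Sum>i\<in>I. moment S L j (f i))"
  by (induction I rule: infinite_finite_induct) (auto simp: moment_add moment_zero)

lemma moment_shift_power:
  "moment S L j ((S ^^ i) h) = (if i \<le> j then moment S L (j - i) h else 0)"
proof (induction i arbitrary: j)
  case (Suc i)
  show ?case
    by (cases j) (simp_all add: moment_Suc_shift moment_0_shift Suc)
qed simp

text \<open>A vanishing \<open>j\<close>-th moment says
  \<open>(L ^^ j) g = S ((L ^^ Suc j) g)\<close>; chaining these equalities pulls out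
  \<open>n\<close> factors \<open>S\<close>.\<close>

lemma moments_zero_imp_range_power:
  assumes "\<And>j. j < n \<Longrightarrow> moment S L j g = 0"
  shows "g = (S ^^ n) ((L ^^ n) g)"
  using assms
proof (induction n)
  case (Suc n)
  then have "(L ^^ n) g = S ((L ^^ Suc n) g)" by (force simp: moment_def)
  moreover have "(S ^^ Suc n) x = (S ^^ n) (S x)" for x by (simp add: funpow_swap1)
  ultimately show ?case using Suc by simp
qed simp

text \<open>Geometric growth gives the power series of moments a radius of convergence bounded below
  independently of \<open>h\<close>.\<close>

lemma moment_bound:
  obtains C K where "C > 0" "K > 0" "\<And>j h. norm (moment S L j h) \<le> C * K ^ j * norm h"
proof -
  obtain K where K: "K > 0" "\<And>x. norm (L x) \<le> norm x * K" using L.pos_bounded by blast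
  obtain M where M: "M > 0" "\<And>x. norm (S x) \<le> norm x * M" using S.pos_bounded by blast
  have Lj: "norm ((L ^^ j) h) \<le> K ^ j * norm h" for j h
  proof (induction j)
    case (Suc j)
    have "norm ((L ^^ Suc j) h) \<le> norm ((L ^^ j) h) * K" by (simp add: K)
    also have "\<dots> \<le> K ^ j * norm h * K" using Suc K by (intro mult_right_mono) auto
    finally show ?case by (simp add: mult_ac)
  qed simp
  have "norm (moment S L j h) \<le> (1 + K * M) * K ^ j * norm h" for j h
  proof -
    have "norm (moment S L j h) \<le> norm ((L ^^ j) h) + norm (S ((L ^^ Suc j) h))"
      unfolding moment_def by (rule norm_triangle_ineq4)
    also have "\<dots> \<le> K ^ j * norm h + K ^ Suc j * norm h * M"
      using M Lj[of "Suc j" h] by (intro add_mono Lj order_trans[OF M(2)] mult_right_mono) auto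
    finally show ?thesis by (simp add: algebra_simps)
  qed
  then show ?thesis using that[of "1 + K * M" K] K M by (simp add: add_pos_pos)
qed

text \<open>\<open>A\<close> multiplies all generating functions by one analytic function, which on
  coefficients is a Cauchy product. The vector \<open>p\<close> normalises: it is its own zeroth
  moment and its other moments vanish, so \<open>T \<mu> p p = cinner p p\<close> is
  nonzero.\<close>

lemma Alg_Lat_moment:
  assumes A: "A \<in> Alg (Lat (W_alg S))" and p: "L p = 0" "p \<noteq> 0"
  obtains a where "\<And>h j. moment S L j (A h) = (\<Sum>i\<le>j. a i *\<^sub>C moment S L (j - i) h)"
proof -
  have bA: "A \<in> bounded_operators" using A by (simp add: Alg_def)
  obtain C K where CK: "C > 0" "K > 0" "\<And>j h. norm (moment S L j h) \<le> C * K ^ j * norm h"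
    using moment_bound by blast
  define T where "T \<mu> y h = (\<Sum>j. cinner (moment S L j h) y * \<mu> ^ j)" for \<mu> y h
  have le: "cmod (cinner (moment S L j h) y * \<mu> ^ j) \<le> C * norm y * norm h * (K * cmod \<mu>) ^ j"
    for j h y \<mu>
  proof -
    have "cmod (cinner (moment S L j h) y * \<mu> ^ j) \<le> norm (moment S L j h) * norm y * cmod \<mu> ^ j"
      by (simp add: norm_mult norm_power cmod_cinner_le mult_right_mono)
    also have "\<dots> \<le> C * K ^ j * norm h * norm y * cmod \<mu> ^ j"
      by (intro mult_right_mono CK) auto
    finally show ?thesis by (simp add: power_mult_distrib mult_ac)
  qed
  \<comment> \<open>On this disc the majorising geometric series has ratio below 1.\<close>
  define D where "D = ball (0::complex) (1 / K)"
  have D: "K * cmod \<mu> < 1" if "\<mu> \<in> D" for \<mu>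
    using that CK by (simp add: D_def field_simps)
  have geo: "summable (\<lambda>j. C * norm y * norm h * (K * cmod \<mu>) ^ j)" if "\<mu> \<in> D" for \<mu> y and h :: 'a
    using D[OF that] CK by (intro summable_mult summable_geometric) (simp add: abs_mult)
  have sm: "summable (\<lambda>j. cinner (moment S L j h) y * \<mu> ^ j)" if "\<mu> \<in> D" for \<mu> y h
    by (rule summable_comparison_test'[OF geo[OF that], of 0]) (rule le)
  have T_sums: "(\<lambda>j. cinner (moment S L j h) y * \<mu> ^ j) sums T \<mu> y h" if "\<mu> \<in> D" for \<mu> y h
    unfolding T_def using sm[OF that] by (rule summable_sums)
  have T_add: "T \<mu> y (h + k) = T \<mu> y h + T \<mu> y k" if "\<mu> \<in> D" for \<mu> y h k
    unfolding T_def
    by (simp add: suminf_add[OF sm[OF that] sm[OF that]] moment_add cinner_add_left distrib_right)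
  have T_scale: "T \<mu> y (c *\<^sub>C h) = c * T \<mu> y h" if "\<mu> \<in> D" for \<mu> y h c
    unfolding T_def
    by (simp add: moment_scaleC cinner_scaleC_left mult.assoc suminf_mult[OF sm[OF that]])
  have T_bounded: "bounded_linear (T \<mu> y)" if "\<mu> \<in> D" for \<mu> y
  proof (rule bounded_linear_intro)
    show "T \<mu> y (r *\<^sub>R h) = r *\<^sub>R T \<mu> y h" for r h
      using T_scale[OF that, of y "of_real r" h] by (simp add: scaleC_of_real scaleR_conv_of_real)
    show "norm (T \<mu> y h) \<le> norm h * (C * norm y * (\<Sum>j. (K * cmod \<mu>) ^ j))" for h
    proof -
      have "norm (T \<mu> y h) \<le> (\<Sum>j. C * norm y * norm h * (K * cmod \<mu>) ^ j)"
        unfolding T_def by (intro norm_suminf_le le geo that)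
      also have "\<dots> = C * norm y * norm h * (\<Sum>j. (K * cmod \<mu>) ^ j)"
        using D[OF that] CK by (intro suminf_mult summable_geometric) (simp add: abs_mult)
      finally show ?thesis by (simp add: mult_ac)
    qed
  qed (rule T_add[OF that])
  have T_eig: "T \<mu> y (S h) = \<mu> * T \<mu> y h" if "\<mu> \<in> D" for \<mu> y h
  proof -
    \<comment> \<open>The series of \<open>S h\<close> is that of \<open>h\<close> moved up by one
      place, with zeroth term 0.\<close>
    have "(\<lambda>j. cinner (moment S L (Suc j) (S h)) y * \<mu> ^ Suc j) sums (\<mu> * T \<mu> y h)"
      using sums_mult[OF T_sums[OF that], of \<mu> h y] by (simp add: moment_Suc_shift mult_ac)
    then have "(\<lambda>j. cinner (moment S L j (S h)) y * \<mu> ^ j) sums (\<mu> * T \<mu> y h + 0)"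
      by (subst (asm) sums_Suc_iff) (simp add: moment_0_shift)
    then show ?thesis using sums_unique2[OF T_sums[OF that, of "S h" y]] by simp
  qed
  have T_p: "T \<mu> y p = cinner p y" if "\<mu> \<in> D" for \<mu> y
  proof -
    have "(L ^^ j) p = 0" if "j > 0" for j
      using that
    proof (induction j)
      case (Suc j)
      then show ?case by (cases j) (simp_all add: p L.zero)
    qed simp
    then have "moment S L j p = 0" if "j \<noteq> 0" for j
      using that by (simp add: moment_def S.zero L.zero del: funpow.simps)
    then have "T \<mu> y p = cinner (moment S L 0 p) y"
      unfolding T_def by (subst suminf_finite[of "{0}"]) auto
    then show ?thesis by (simp add: moment_def p S.zero)
  qed
  \<comment> \<open>The kernel of \<open>\<alpha> T\<^sub>y - \<beta> T\<^sub>z\<close> is invariant, being the kernel of an eigenfunctional.\<close>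
  have det: "T \<mu> y (A h) * T \<mu> z h = T \<mu> z (A h) * T \<mu> y h" if "\<mu> \<in> D" for \<mu> y z h
  proof -
    let ?Q = "\<lambda>x. T \<mu> y x * T \<mu> z h - T \<mu> z x * T \<mu> y h"
    have "?Q (A h) = 0"
    proof (rule Alg_Lat_eigenfunctional[OF S _ _ _ A, where \<mu>=\<mu>])
      show "bounded_linear ?Q"
        by (intro bounded_linear_sub bounded_linear_mult_left[THEN bounded_linear_compose] T_bounded that)
    qed (simp_all add: T_scale T_eig that algebra_simps)
    then show ?thesis by simp
  qed
  \<comment> \<open>These are the Taylor coefficients of the multiplier
    \<open>T \<mu> p (A p) / cinner p p\<close>.\<close>
  define a where "a i = cinner (moment S L i (A p)) p / cinner p p" for i
  have pp: "cinner p p \<noteq> 0" using p by (simp add: cinner_self)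
  have mult: "T \<mu> y (A h) = T \<mu> p (A p) / cinner p p * T \<mu> y h" if \<mu>: "\<mu> \<in> D" for \<mu> y h
  proof -
    define \<phi> where "\<phi> = T \<mu> p (A p) / cinner p p"
    note [simp] = T_add[OF \<mu>] linear_add[OF bounded_linear.linear[OF bounded_operatorsD(1)[OF bA]]]
    note T_diff = linear_diff[OF bounded_linear.linear[OF T_bounded]]
    note A_diff = linear_diff[OF bounded_linear.linear[OF bounded_operatorsD(1)[OF bA]]]
    have nz: "T \<mu> y (A h) = \<phi> * T \<mu> y h" if "T \<mu> p h \<noteq> 0" for y h
    proof -
      have 1: "T \<mu> p (A h) = \<phi> * T \<mu> p h"
      proof -
        \<comment> \<open>The argument of \<open>A\<close> lies in the kernel of
          \<open>T \<mu> p\<close>; expanding by linearity yields the multiplier for this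
          functional, and \<open>det\<close> carries it over to every \<open>y\<close>.\<close>
        have "T \<mu> p (A (T \<mu> p p *\<^sub>C h - T \<mu> p h *\<^sub>C p)) = 0"
          by (rule Alg_Lat_eigenfunctional[OF S T_bounded[OF \<mu>] T_scale[OF \<mu>] T_eig[OF \<mu>] A])
            (simp add: T_diff[OF \<mu>] T_scale[OF \<mu>])
        then show ?thesis
          using pp by (simp add: \<phi>_def T_diff[OF \<mu>] T_scale[OF \<mu>] A_diff
              bounded_operatorsD(2)[OF bA] T_p[OF \<mu>] field_simps)
      qed
      then show ?thesis using det[OF \<mu>, of y h p] that by (simp add: field_simps)
    qed
    show ?thesis
    proof (cases "T \<mu> p h = 0")
      case True
      \<comment> \<open>Here \<open>T \<mu> p h\<close> cannot be cancelled, so the identity for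
        \<open>h\<close> is obtained as the one for \<open>h + p\<close> minus the one for
        \<open>p\<close>.\<close>
      then have "T \<mu> p (h + p) \<noteq> 0" "T \<mu> p p \<noteq> 0" using pp by (simp_all add: T_p[OF \<mu>])
      from nz[OF this(1), of y] nz[OF this(2), of y] show ?thesis
        unfolding \<phi>_def[symmetric] by (simp add: algebra_simps)
    qed (simp add: nz flip: \<phi>_def)
  qed
  have "moment S L j (A h) = (\<Sum>i\<le>j. a i *\<^sub>C moment S L (j - i) h)" for h j
  proof (rule cinner_eqI)
    fix y
    have ev: "\<forall>\<^sub>F \<mu> in nhds 0. \<mu> \<in> D"
      using CK by (intro eventually_nhds_in_open) (auto simp: D_def)
    have lhs: "(\<lambda>\<mu>. T \<mu> y (A h)) has_fps_expansion Abs_fps (\<lambda>j. cinner (moment S L j (A h)) y)"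
      by (rule has_fps_expansionI, rule eventually_mono[OF ev]) (simp add: T_sums)
    have "(\<lambda>\<mu>. T \<mu> y h) has_fps_expansion Abs_fps (\<lambda>j. cinner (moment S L j h) y)"
      by (rule has_fps_expansionI, rule eventually_mono[OF ev]) (simp add: T_sums)
    moreover have "(\<lambda>\<mu>. T \<mu> p (A p) / cinner p p) has_fps_expansion Abs_fps a"
      using sums_divide[OF T_sums]
      by (intro has_fps_expansionI eventually_mono[OF ev]) (simp add: a_def)
    ultimately have "(\<lambda>\<mu>. T \<mu> p (A p) / cinner p p * T \<mu> y h) has_fps_expansion
        Abs_fps a * Abs_fps (\<lambda>j. cinner (moment S L j h) y)"
      by (intro has_fps_expansion_mult)
    \<comment> \<open>\<open>mult\<close> is known only on \<open>D\<close>, which suffices because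
      an expansion depends only on values near 0.\<close>
    then have "(\<lambda>\<mu>. T \<mu> y (A h)) has_fps_expansion
        Abs_fps a * Abs_fps (\<lambda>j. cinner (moment S L j h) y)"
      by (subst has_fps_expansion_cong[OF eventually_mono[OF ev mult] refl])
    with lhs have "Abs_fps (\<lambda>j. cinner (moment S L j (A h)) y)
        = Abs_fps a * Abs_fps (\<lambda>j. cinner (moment S L j h) y)"
      by (rule fps_expansion_unique_complex)
    then show "cinner (moment S L j (A h)) y = cinner (\<Sum>i\<le>j. a i *\<^sub>C moment S L (j - i) h) y"
      by (simp add: fps_eq_iff fps_mult_nth cinner_sum_left cinner_scaleC_left atLeast0AtMost)
  qed
  then show ?thesis by (rule that)
qed

text \<open>The polynomial and \<open>A h\<close> have the same first \<open>n\<close> moments,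
  since terms with \<open>i > j\<close> contribute nothing to the \<open>j\<close>-th
  moment.\<close>

lemma Alg_Lat_polynomial_mod_range:
  assumes A: "A \<in> Alg (Lat (W_alg S))" and p: "L p = 0" "p \<noteq> 0"
  obtains a where "\<And>h n. A h - (\<Sum>i<n. a i *\<^sub>C (S ^^ i) h) \<in> range (S ^^ n)"
proof -
  obtain a where a: "\<And>h j. moment S L j (A h) = (\<Sum>i\<le>j. a i *\<^sub>C moment S L (j - i) h)"
    using Alg_Lat_moment[OF assms] by blast
  have "moment S L j (A h - (\<Sum>i<n. a i *\<^sub>C (S ^^ i) h)) = 0" if "j < n" for j n h
  proof -
    have "(\<Sum>i<n. a i *\<^sub>C moment S L j ((S ^^ i) h)) = (\<Sum>i\<le>j. a i *\<^sub>C moment S L (j - i) h)"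
      using that by (intro sum.mono_neutral_cong_right) (auto simp: moment_shift_power)
    then show ?thesis by (simp add: moment_diff moment_sum moment_scaleC a)
  qed
  then have "A h - (\<Sum>i<n. a i *\<^sub>C (S ^^ i) h) \<in> range (S ^^ n)" for h n
    by - (rule range_eqI, rule moments_zero_imp_range_power, blast)
  then show ?thesis by (rule that)
qed

end

section \<open>Weak convergence of square-summable functions\<close>

definition cut :: "'v set \<Rightarrow> 'v ell2 \<Rightarrow> 'v ell2" where
  "cut D f = Abs_ell2 (\<lambda>v. if v \<in> D then ell2_fun f v else 0)"

lemma ell2_fun_cut: "ell2_fun (cut D f) v = (if v \<in> D then ell2_fun f v else 0)"
proof -
  have "square_summable (\<lambda>v. if v \<in> D then ell2_fun f v else 0)"
    unfolding square_summable_def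
    by (rule summable_on_comparison_test[OF square_summable_ell2_fun[of f, unfolded square_summable_def]])
      auto
  then show ?thesis by (simp add: cut_def ell2_fun_Abs)
qed

lemma norm_cut_square: "(norm (cut D f))\<^sup>2 = (\<Sum>\<^sub>\<infinity>v\<in>D. (cmod (ell2_fun f v))\<^sup>2)"
  unfolding norm_ell2_square by (rule infsum_cong_neutral) (auto simp: ell2_fun_cut)

lemma ell2_fun_sum: "ell2_fun (\<Sum>i\<in>I. f i) v = (\<Sum>i\<in>I. ell2_fun (f i) v)"
  by (induction I rule: infinite_finite_induct) (auto simp: ell2_fun_zero ell2_fun_add)

lemma has_sum_finite_sum:
  fixes f :: "'i \<Rightarrow> 'v \<Rightarrow> 'b::topological_comm_monoid_add"
  assumes "\<And>i. i \<in> I \<Longrightarrow> (f i has_sum s i) A"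
  shows "((\<lambda>v. \<Sum>i\<in>I. f i v) has_sum (\<Sum>i\<in>I. s i)) A"
  using assms
  by (induction I rule: infinite_finite_induct) (auto intro: has_sum_add)

lemma norm_ell2_le:
  assumes "\<And>F. finite F \<Longrightarrow> (\<Sum>v\<in>F. (cmod (ell2_fun f v))\<^sup>2) \<le> B\<^sup>2" and "0 \<le> B"
  shows "norm f \<le> B"
proof (rule power2_le_imp_le)
  show "(norm f)\<^sup>2 \<le> B\<^sup>2"
    unfolding norm_ell2_square using assms square_summable_ell2_fun[of f]
    by (intro infsum_le_finite_sums) (auto simp: square_summable_def)
qed fact

lemma ell2_finite_approx:
  assumes "e > 0"
  obtains F where "finite F" "norm (y - cut F y) < e"
proof -
  let ?f = "\<lambda>v. (cmod (ell2_fun y v))\<^sup>2"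
  have sm: "?f summable_on UNIV"
    using square_summable_ell2_fun[of y] by (simp add: square_summable_def)
  then obtain F where F: "finite F" "dist (sum ?f F) (infsum ?f UNIV) \<le> (e / 2)\<^sup>2"
    using infsum_finite_approximation[of ?f UNIV "(e / 2)\<^sup>2"] assms by auto
  have "y - cut F y = cut (- F) y"
    by (rule ell2_eqI) (simp add: ell2_fun_diff ell2_fun_cut)
  then have "(norm (y - cut F y))\<^sup>2 = infsum ?f (UNIV - F)"
    by (simp add: norm_cut_square Compl_eq_Diff_UNIV)
  also have "\<dots> = infsum ?f UNIV - sum ?f F"
    using F(1) sm by (subst infsum_Diff) auto
  also have "\<dots> \<le> (e / 2)\<^sup>2"
    using F(2) by (simp add: dist_real_def)
  finally have "norm (y - cut F y) \<le> e / 2"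
    by (rule power2_le_imp_le) (use assms in simp)
  then show ?thesis using that F(1) assms by force
qed

lemma cinner_cut_right:
  assumes "finite F"
  shows "cinner x (cut F y) = (\<Sum>v\<in>F. ell2_fun x v * cnj (ell2_fun y v))"
proof -
  have "cinner x (cut F y) = (\<Sum>\<^sub>\<infinity>v\<in>F. ell2_fun x v * cnj (ell2_fun y v))"
    unfolding cinner_ell2_def by (rule infsum_cong_neutral) (auto simp: ell2_fun_cut)
  then show ?thesis using assms by simp
qed

text \<open>Coordinatewise convergence settles finitely supported \<open>y\<close>; the uniform norm
  bound controls the error of approximating a general \<open>y\<close> by these.\<close>

lemma bounded_coordinatewise_imp_weak:
  assumes coord: "\<And>v. (\<lambda>n. ell2_fun (X n) v) \<longlonglongrightarrow> ell2_fun x v"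
    and bound: "\<And>n. norm (X n) \<le> C"
  shows "(\<lambda>n. cinner (X n) y) \<longlonglongrightarrow> cinner x y"
proof (rule LIMSEQ_I)
  fix e :: real assume e: "0 < e"
  define M where "M = C + norm x + 1"
  have "0 \<le> C" using bound[of 0] norm_ge_zero order_trans by blast
  then have M: "M > 0" using norm_ge_zero[of x] unfolding M_def by linarith
  obtain F where F: "finite F" "norm (y - cut F y) < e / (2 * M)"
    using ell2_finite_approx[of "e / (2 * M)" y] e M by auto
  have "(\<lambda>n. cinner (X n) (cut F y)) \<longlonglongrightarrow> cinner x (cut F y)"
    unfolding cinner_cut_right[OF F(1)] by (intro tendsto_intros coord)
  then obtain N where
    N: "\<And>n. n \<ge> N \<Longrightarrow> cmod (cinner (X n) (cut F y) - cinner x (cut F y)) < e / 2"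
    using LIMSEQ_D[of _ _ "e / 2"] e by (metis half_gt_zero)
  have "cmod (cinner (X n) y - cinner x y) < e" if "n \<ge> N" for n
  proof -
    have "cinner (X n) y - cinner x y
        = (cinner (X n) (cut F y) - cinner x (cut F y)) + cinner (X n - x) (y - cut F y)"
      using cinner_add_right[of "X n - x" "cut F y" "y - cut F y"]
      by (simp add: cinner_diff_left)
    moreover have "cmod (cinner (X n - x) (y - cut F y)) \<le> e / 2"
    proof -
      have "norm (X n - x) \<le> M"
        using norm_triangle_ineq4[of "X n" x] bound[of n] by (simp add: M_def)
      then have "norm (X n - x) * norm (y - cut F y) \<le> M * (e / (2 * M))"
        using F(2) M by (intro mult_mono) auto
      with cmod_cinner_le[of "X n - x" "y - cut F y"] show ?thesis using M by simp
    qed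
    ultimately show ?thesis
      using N[OF that] norm_triangle_lt[of "cinner (X n) (cut F y) - cinner x (cut F y)"] by auto
  qed
  then show "\<exists>no. \<forall>n\<ge>no. norm (cinner (X n) y - cinner x y) < e" by auto
qed

section \<open>Fejer means on a rooted tree\<close>

text \<open>\<open>d\<close> is the length of a shortest directed path from the root. Parents being
  unique, every path arriving at \<open>v\<close> along an edge comes through \<open>u\<close>, so
  the two lengths differ by exactly one.\<close>

lemma depth_function_exists:
  assumes "rooted_directed_tree E"
  obtains d :: "'v \<Rightarrow> nat" where "\<And>u v. (u, v) \<in> E \<Longrightarrow> d v = Suc (d u)"
proof -
  obtain r where r: "is_root E r" and r_unique: "\<And>v. is_root E v \<Longrightarrow> v = r"
    using assms unfolding rooted_directed_tree_def by blast
  have conn: "(r, v) \<in> (E \<union> E\<inverse>)\<^sup>*" and parent: "(u, v) \<in> E \<Longrightarrow> (u', v) \<in> E \<Longrightarrow> u = u'" for u u' v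
    using assms unfolding rooted_directed_tree_def directed_tree_def by blast+
  have reach: "(r, v) \<in> E\<^sup>*" for v
    using conn[of v]
  proof (induction rule: rtrancl_induct)
    case (step v v')
    show ?case
    proof (cases "(v, v') \<in> E")
      case False
      \<comment> \<open>On a backward step, the directed path to \<open>v\<close> ends with the edge
        from its only parent \<open>v'\<close>; dropping that edge reaches
        \<open>v'\<close>.\<close>
      then have "(v', v) \<in> E" using step by auto
      moreover obtain u where "(r, u) \<in> E\<^sup>*" "(u, v) \<in> E"
        using step.IH \<open>(v', v) \<in> E\<close> r unfolding is_root_def by (metis rtranclE)
      ultimately show ?thesis using parent by blast
    qed (use step in auto)
  qed simp
  define d where "d v = (LEAST n. (r, v) \<in> E ^^ n)" for v
  have d: "(r, v) \<in> E ^^ d v" and d_le: "(r, v) \<in> E ^^ n \<Longrightarrow> d v \<le> n" for v n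
    using reach[of v] unfolding d_def by (auto simp: rtrancl_power intro: LeastI Least_le)
  have "d v = Suc (d u)" if uv: "(u, v) \<in> E" for u v
  proof (rule antisym)
    show "d v \<le> Suc (d u)" using d[of u] uv by (intro d_le) auto
    have "d v \<noteq> 0" using d[of v] uv r unfolding is_root_def by (cases "d v") auto
    then obtain n where n: "d v = Suc n" using not0_implies_Suc by blast
    then obtain u' where "(r, u') \<in> E ^^ n" "(u', v) \<in> E" using d[of v] by auto
    then show "Suc (d u) \<le> d v" using parent[OF uv] d_le n by auto
  qed
  then show ?thesis by (rule that)
qed

lemma par_edge:
  assumes "directed_tree E" "\<not> is_root E v"
  shows "(par E v, v) \<in> E"
proof -
  obtain u where "(u, v) \<in> E" using assms unfolding is_root_def by blast
  then show ?thesis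
    using assms(1) unfolding par_def directed_tree_def by (metis theI)
qed

text \<open>With full domain the default value \<open>0\<close> of the totalised shift never
  occurs.\<close>

lemma ell2_fun_weighted_shift:
  assumes "shift_domain E w = UNIV"
  shows "ell2_fun (weighted_shift E w f) v
    = (if is_root E v then 0 else complex_of_real (w v) * ell2_fun f (par E v))"
proof -
  have "f \<in> shift_domain E w" using assms by simp
  then show ?thesis
    unfolding weighted_shift_def shift_domain_def by (simp add: ell2_fun_Abs shift_fun_def)
qed

context
  fixes E :: "('v \<times> 'v) set" and w :: "'v \<Rightarrow> real" and d :: "'v \<Rightarrow> nat"
    and S :: "'v ell2 \<Rightarrow> 'v ell2"
  assumes tree: "directed_tree E" and dom: "shift_domain E w = UNIV"
    and depth: "\<And>u v. (u, v) \<in> E \<Longrightarrow> d v = Suc (d u)"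
  defines "S \<equiv> weighted_shift E w"
begin

section \<open>Powers of the shift and generations\<close>

lemma shift_apply:
  "ell2_fun (S f) v = (if is_root E v then 0 else complex_of_real (w v) * ell2_fun f (par E v))"
  unfolding S_def by (rule ell2_fun_weighted_shift[OF dom])

lemma depth_par: "\<not> is_root E v \<Longrightarrow> d v = Suc (d (par E v))"
  by (intro depth par_edge tree)

text \<open>Climbing from \<open>v\<close> meets the root in fewer than \<open>i\<close> steps, and
  every shifted function vanishes there.\<close>

lemma shift_power_zero: "d v < i \<Longrightarrow> ell2_fun ((S ^^ i) f) v = 0"
proof (induction i arbitrary: v)
  case (Suc i)
  then show ?case by (auto simp: shift_apply depth_par)
qed simp

text \<open>The value at \<open>v\<close> involves \<open>f\<close> only at the \<open>i\<close>-th
  ancestor, if there is one, and its depth is \<open>d v - i\<close>.\<close>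

lemma shift_power_cut:
  "i \<le> d v \<Longrightarrow> ell2_fun ((S ^^ i) (cut {u. d u \<in> D} f)) v
     = (if d v - i \<in> D then ell2_fun ((S ^^ i) f) v else 0)"
proof (induction i arbitrary: v)
  case (Suc i)
  then show ?case by (auto simp: shift_apply depth_par)
qed (simp add: ell2_fun_cut)

text \<open>For \<open>N > 0\<close> this is the Cesaro mean of the partial sums over
  \<open>i < n\<close>, for \<open>n\<close> from 1 to \<open>N\<close>, of the formal series of the
  \<open>a i *\<^sub>C (S ^^ i) f\<close>.\<close>

definition fejer :: "(nat \<Rightarrow> complex) \<Rightarrow> nat \<Rightarrow> 'v ell2 \<Rightarrow> 'v ell2" where
  "fejer a N f = (\<Sum>i<N. (of_nat (N - i) / of_nat N * a i) *\<^sub>C (S ^^ i) f)"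

lemma fejer_apply:
  "ell2_fun (fejer a N f) v
    = (\<Sum>i\<le>d v. of_nat (N - i) / of_nat N * a i * ell2_fun ((S ^^ i) f) v)"
proof -
  let ?g = "\<lambda>i. of_nat (N - i) / of_nat N * a i * ell2_fun ((S ^^ i) f) v"
  have "ell2_fun (fejer a N f) v = (\<Sum>i<N. ?g i)"
    by (simp add: fejer_def ell2_fun_sum ell2_fun_scaleC)
  \<comment> \<open>Added terms have weight 0 by truncated subtraction; the terms dropped next
    vanish because \<open>i\<close> exceeds the depth.\<close>
  also have "\<dots> = (\<Sum>i\<in>{..<N} \<union> {..d v}. ?g i)"
    by (intro sum.mono_neutral_left) auto
  also have "\<dots> = (\<Sum>i\<le>d v. ?g i)"
    by (intro sum.mono_neutral_right) (auto simp: shift_power_zero)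
  finally show ?thesis .
qed

text \<open>
  The compression to the generations \<open>k - N, \<dots>, k - 1\<close> keeps the \<open>i\<close>-th diagonal of \<open>A\<close> at depth \<open>m\<close>
  for exactly \<open>N - i\<close> of the \<open>N\<close> values \<open>k\<close> in \<open>{m<..m + N}\<close>. The bounds on \<open>k\<close> avoid truncated subtraction.
\<close>

lemma fejer_average:
  assumes A: "\<And>f v. ell2_fun (A f) v = (\<Sum>i\<le>d v. a i * ell2_fun ((S ^^ i) f) v)" and "N > 0"
  shows "of_nat N * ell2_fun (fejer a N f) v
    = (\<Sum>k\<in>{d v<..d v + N}. ell2_fun (A (cut {u. d u \<in> {m. m < k \<and> k \<le> m + N}} f)) v)"
proof -
  have "(\<Sum>k\<in>{d v<..d v + N}. ell2_fun (A (cut {u. d u \<in> {m. m < k \<and> k \<le> m + N}} f)) v)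
    = (\<Sum>k\<in>{d v<..d v + N}. \<Sum>i\<le>d v. a i *
        (if d v - i < k \<and> k \<le> d v - i + N then ell2_fun ((S ^^ i) f) v else 0))"
    unfolding A by (intro sum.cong refl, subst shift_power_cut) auto
  also have "\<dots> = (\<Sum>i\<le>d v. \<Sum>k\<in>{d v<..d v + N}. a i *
        (if d v - i < k \<and> k \<le> d v - i + N then ell2_fun ((S ^^ i) f) v else 0))"
    by (rule sum.swap)
  also have "\<dots> = (\<Sum>i\<le>d v. of_nat (N - i) * a i * ell2_fun ((S ^^ i) f) v)"
  proof (intro sum.cong refl)
    fix i assume "i \<in> {..d v}"
    \<comment> \<open>The lower bound \<open>d v - i < k\<close> is automatic, so only the upper one
      restricts \<open>k\<close>; it leaves \<open>N - i\<close> values, none if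
      \<open>i \<ge> N\<close>.\<close>
    have "(\<Sum>k\<in>{d v<..d v + N}. a i *
          (if d v - i < k \<and> k \<le> d v - i + N then ell2_fun ((S ^^ i) f) v else 0))
        = (\<Sum>k\<in>{d v<..d v - i + N}. a i * ell2_fun ((S ^^ i) f) v)"
      using \<open>i \<in> {..d v}\<close> by (intro sum.mono_neutral_cong_right) auto
    also have "\<dots> = of_nat (d v - i + N - d v) * (a i * ell2_fun ((S ^^ i) f) v)"
      by simp
    also have "d v - i + N - d v = N - i" using \<open>i \<in> {..d v}\<close> by auto
    finally show "(\<Sum>k\<in>{d v<..d v + N}. a i *
          (if d v - i < k \<and> k \<le> d v - i + N then ell2_fun ((S ^^ i) f) v else 0))
        = of_nat (N - i) * a i * ell2_fun ((S ^^ i) f) v" by (simp add: mult.assoc)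
  qed
  also have "\<dots> = of_nat N * ell2_fun (fejer a N f) v"
    using \<open>N > 0\<close> by (simp add: fejer_apply sum_distrib_left)
  finally show ?thesis by simp
qed

text \<open>Cauchy-Schwarz over the \<open>N\<close> windows of a vertex costs one factor
  \<open>N\<close>, and the overlap of the windows, \<open>N\<close> at each depth, another.
  Together they cancel the square of the averaging factor \<open>1 / N\<close>.\<close>

lemma norm_fejer_le:
  assumes A: "\<And>f v. ell2_fun (A f) v = (\<Sum>i\<le>d v. a i * ell2_fun ((S ^^ i) f) v)"
    and bound: "\<And>f. norm (A f) \<le> K * norm f" and "N > 0" and "0 \<le> K"
  shows "norm (fejer a N f) \<le> K * norm f"
proof (rule norm_ell2_le)
  fix F :: "'v set" assume F: "finite F"
  define Q where "Q k = cut {u. d u \<in> {m. m < k \<and> k \<le> m + N}} f" for k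
  \<comment> \<open>\<open>M\<close> exceeds every window index relevant to a vertex of
    \<open>F\<close>, so one finite range of \<open>k\<close> serves all of them.\<close>
  define M where "M = (\<Sum>v\<in>F. d v) + N"
  have M: "{d v<..d v + N} \<subseteq> {..M}" if "v \<in> F" for v
    using member_le_sum[of v F d] F that by (auto simp: M_def)
  have Q: "(\<Sum>k\<le>M. (norm (Q k))\<^sup>2) \<le> N * (norm f)\<^sup>2"
  proof -
    let ?f = "\<lambda>v. (cmod (ell2_fun f v))\<^sup>2"
    have sm: "?f summable_on UNIV"
      using square_summable_ell2_fun[of f] by (simp add: square_summable_def)
    have "((\<lambda>v. (cmod (ell2_fun (Q k) v))\<^sup>2) has_sum (norm (Q k))\<^sup>2) UNIV" for k
      using square_summable_ell2_fun[of "Q k"] by (simp add: square_summable_def norm_ell2_square)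
    from has_sum_finite_sum[of "{..M}", OF this]
    have Qs: "((\<lambda>v. \<Sum>k\<le>M. (cmod (ell2_fun (Q k) v))\<^sup>2) has_sum (\<Sum>k\<le>M. (norm (Q k))\<^sup>2)) UNIV" .
    from infsumI[OF Qs]
    have "(\<Sum>k\<le>M. (norm (Q k))\<^sup>2) = (\<Sum>\<^sub>\<infinity>v. \<Sum>k\<le>M. (cmod (ell2_fun (Q k) v))\<^sup>2)" ..
    also have "\<dots> \<le> (\<Sum>\<^sub>\<infinity>v. N * ?f v)"
    proof (rule infsum_mono)
      show "(\<lambda>v. \<Sum>k\<le>M. (cmod (ell2_fun (Q k) v))\<^sup>2) summable_on UNIV"
        using Qs by (rule has_sum_imp_summable)
      show "(\<lambda>v. N * ?f v) summable_on UNIV" by (rule summable_on_cmult_right[OF sm])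
      fix v
      \<comment> \<open>The coordinate at \<open>v\<close> survives in \<open>Q k\<close> only for
        the \<open>N\<close> indices in \<open>{d v<..d v + N}\<close>.\<close>
      have "(\<Sum>k\<le>M. (cmod (ell2_fun (Q k) v))\<^sup>2) = (\<Sum>k\<in>{..M} \<inter> {d v<..d v + N}. ?f v)"
        by (intro sum.mono_neutral_cong_right) (auto simp: Q_def ell2_fun_cut)
      also have "\<dots> \<le> (\<Sum>k\<in>{d v<..d v + N}. ?f v)"
        by (intro sum_mono2) auto
      finally show "(\<Sum>k\<le>M. (cmod (ell2_fun (Q k) v))\<^sup>2) \<le> N * ?f v" by simp
    qed
    also have "\<dots> = N * (norm f)\<^sup>2"
      by (simp add: norm_ell2_square infsum_cmult_right[OF sm])
    finally show ?thesis .
  qed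
  have pointwise: "(N * cmod (ell2_fun (fejer a N f) v))\<^sup>2 \<le> N * (\<Sum>k\<le>M. (cmod (ell2_fun (A (Q k)) v))\<^sup>2)"
    if "v \<in> F" for v
  proof -
    have "N * cmod (ell2_fun (fejer a N f) v) = cmod (of_nat N * ell2_fun (fejer a N f) v)"
      by (simp add: norm_mult)
    also have "\<dots> \<le> (\<Sum>k\<in>{d v<..d v + N}. cmod (ell2_fun (A (Q k)) v))"
      unfolding fejer_average[OF A \<open>N > 0\<close>] Q_def by (rule norm_sum)
    finally have "(N * cmod (ell2_fun (fejer a N f) v))\<^sup>2
        \<le> (\<Sum>k\<in>{d v<..d v + N}. cmod (ell2_fun (A (Q k)) v))\<^sup>2"
      by (intro power_mono) auto
    also have "\<dots> \<le> (\<Sum>k\<in>{d v<..d v + N}. (cmod (ell2_fun (A (Q k)) v))\<^sup>2) * N"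
      using sum_squared_le_sum_of_squares[of _ "{d v<..d v + N}"] by simp
    also have "\<dots> \<le> (\<Sum>k\<le>M. (cmod (ell2_fun (A (Q k)) v))\<^sup>2) * N"
      using M[OF that] by (intro mult_right_mono sum_mono2) auto
    finally show ?thesis by (simp add: mult.commute)
  qed
  have "(real N)\<^sup>2 * (\<Sum>v\<in>F. (cmod (ell2_fun (fejer a N f) v))\<^sup>2)
      = (\<Sum>v\<in>F. (N * cmod (ell2_fun (fejer a N f) v))\<^sup>2)"
    by (simp add: sum_distrib_left power_mult_distrib)
  also have "\<dots> \<le> (\<Sum>v\<in>F. N * (\<Sum>k\<le>M. (cmod (ell2_fun (A (Q k)) v))\<^sup>2))"
    by (rule sum_mono) (rule pointwise)
  also have "\<dots> = N * (\<Sum>k\<le>M. \<Sum>v\<in>F. (cmod (ell2_fun (A (Q k)) v))\<^sup>2)"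
    by (subst sum.swap) (simp add: sum_distrib_left)
  also have "\<dots> \<le> N * (\<Sum>k\<le>M. (K * norm (Q k))\<^sup>2)"
    using bound by (intro mult_left_mono sum_mono order_trans[OF sum_le_norm_ell2[OF F]] power_mono) auto
  also have "\<dots> = N * K\<^sup>2 * (\<Sum>k\<le>M. (norm (Q k))\<^sup>2)"
    by (simp add: power_mult_distrib sum_distrib_left mult.assoc)
  also have "\<dots> \<le> N * K\<^sup>2 * (N * (norm f)\<^sup>2)"
    using Q by (intro mult_left_mono) auto
  also have "\<dots> = (real N)\<^sup>2 * (K * norm f)\<^sup>2"
    by (simp add: power2_eq_square mult_ac)
  finally show "(\<Sum>v\<in>F. (cmod (ell2_fun (fejer a N f) v))\<^sup>2) \<le> (K * norm f)\<^sup>2"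
    using \<open>N > 0\<close> by simp
qed (use \<open>0 \<le> K\<close> in simp)

text \<open>At a fixed vertex only finitely many diagonals contribute, and the weight of each tends
  to 1. \<open>Suc n\<close> keeps the denominator nonzero.\<close>

lemma fejer_tendsto:
  assumes A: "\<And>f v. ell2_fun (A f) v = (\<Sum>i\<le>d v. a i * ell2_fun ((S ^^ i) f) v)"
  shows "(\<lambda>n. ell2_fun (fejer a (Suc n) f) v) \<longlonglongrightarrow> ell2_fun (A f) v"
proof -
  have "(\<lambda>n. complex_of_nat (Suc n - i) / of_nat (Suc n)) \<longlonglongrightarrow> 1" for i
  proof (rule Lim_transform_eventually)
    have "(\<lambda>n. 1 - of_nat i * (1 / complex_of_nat (Suc n))) \<longlonglongrightarrow> 1 - of_nat i * 0"
      using LIMSEQ_Suc[OF lim_1_over_n] by (intro tendsto_intros)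
    then show "(\<lambda>n. 1 - of_nat i * (1 / complex_of_nat (Suc n))) \<longlonglongrightarrow> 1" by simp
    show "\<forall>\<^sub>F n in sequentially. 1 - of_nat i * (1 / complex_of_nat (Suc n))
        = complex_of_nat (Suc n - i) / of_nat (Suc n)"
      using eventually_ge_at_top[of i]
      by eventually_elim (simp add: of_nat_diff diff_divide_distrib del: of_nat_Suc)
  qed
  then have "(\<lambda>n. ell2_fun (fejer a (Suc n) f) v)
      \<longlonglongrightarrow> (\<Sum>i\<le>d v. 1 * a i * ell2_fun ((S ^^ i) f) v)"
    unfolding fejer_apply by (intro tendsto_intros)
  then show ?thesis by (simp add: A)
qed

text \<open>The Fejer means are polynomials in \<open>S\<close>, hence lie in every algebra
  \<open>W\<close> of the intersection; being uniformly bounded and coordinatewise convergent, they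
  tend weakly to \<open>A\<close>.\<close>

lemma multiplier_in_W_alg:
  assumes bA: "A \<in> bounded_operators"
    and A: "\<And>f v. ell2_fun (A f) v = (\<Sum>i\<le>d v. a i * ell2_fun ((S ^^ i) f) v)"
  shows "A \<in> W_alg S"
  unfolding W_alg_def
proof (intro InterI, clarsimp)
  fix W assume W: "operator_subalgebra W" "S \<in> W" "id \<in> W" "closedin weak_operator_topology W"
  have power: "S ^^ i \<in> W" for i
    using W by (induction i) (auto simp: operator_subalgebra_def)
  have "(\<lambda>f. \<Sum>i<n. c i *\<^sub>C (S ^^ i) f) \<in> W" for n c
    by (induction n) (use W power in \<open>auto simp: operator_subalgebra_def\<close>)
  then have fejer_W: "fejer a N \<in> W" for N
    unfolding fejer_def[abs_def] .
  obtain K where K: "K > 0" "\<And>f. norm (A f) \<le> norm f * K"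
    using bounded_linear.pos_bounded[OF bounded_operatorsD(1)[OF bA]] by blast
  show "A \<in> W"
  proof (rule closedin_WOT_limit[OF W(4) _ bA])
    show "fejer a (Suc n) \<in> W" for n by (rule fejer_W)
    show "(\<lambda>n. cinner (fejer a (Suc n) x) y) \<longlonglongrightarrow> cinner (A x) y" for x y
      using K by (intro bounded_coordinatewise_imp_weak[where C="K * norm x"] fejer_tendsto[OF A]
          norm_fejer_le[OF A]) (auto simp: mult.commute)
  qed
qed

end

theorem corollary30:
  fixes E :: "('v \<times> 'v) set" and w :: "'v \<Rightarrow> real"
  assumes "infinite (UNIV :: 'v set)" and "countable (UNIV :: 'v set)"
    and "rooted_directed_tree E" and "leafless E"
    and "\<And>v. \<not> is_root E v \<Longrightarrow> w v > 0"
    and "shift_domain E w = UNIV" and "weighted_shift E w \<in> bounded_operators"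
    and "left_invertible (weighted_shift E w)"
  shows "reflexive_operator (weighted_shift E w)"
proof -
  define S where "S = weighted_shift E w"
  note dom = \<open>shift_domain E w = UNIV\<close>
  have S: "S \<in> bounded_operators" using assms by (simp add: S_def)
  obtain L where L: "L \<in> bounded_operators" and "L \<circ> S = id"
    using \<open>left_invertible (weighted_shift E w)\<close> unfolding left_invertible_def S_def by blast
  then have LS: "L (S f) = f" for f by (metis comp_apply id_apply)
  have tree: "directed_tree E" and "\<exists>r. is_root E r"
    using \<open>rooted_directed_tree E\<close> unfolding rooted_directed_tree_def by auto
  then obtain r where r: "is_root E r" by blast
  obtain d :: "'v \<Rightarrow> nat" where d: "\<And>u v. (u, v) \<in> E \<Longrightarrow> d v = Suc (d u)"
    using depth_function_exists[OF \<open>rooted_directed_tree E\<close>] by blast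
  have "square_summable (\<lambda>v. if v = r then 1 else 0)"
    unfolding square_summable_def
    by (rule finite_nonzero_values_imp_summable_on) (rule finite_subset[of _ "{r}"], auto)
  \<comment> \<open>\<open>p\<close> is the image of the indicator \<open>e\<close> of the root
    under \<open>I - S L\<close>. It is killed by \<open>L\<close>, and it is nonzero because
    functions in the range of \<open>S\<close> vanish at the root.\<close>
  define e where "e = Abs_ell2 (\<lambda>v. if v = r then 1 else 0)"
  define p where "p = e - S (L e)"
  have "ell2_fun p r = 1"
    using \<open>square_summable _\<close>
    by (simp add: p_def e_def ell2_fun_diff ell2_fun_Abs S_def ell2_fun_weighted_shift[OF dom] r)
  then have "p \<noteq> 0" by (auto simp: ell2_fun_zero)
  have "L p = 0"
    using linear_diff[OF bounded_linear.linear[OF bounded_operatorsD(1)[OF L]]]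
    by (simp add: p_def LS)
  have "A \<in> W_alg S" if A: "A \<in> Alg (Lat (W_alg S))" for A
  proof -
    obtain a where a: "\<And>h n. A h - (\<Sum>i<n. a i *\<^sub>C (S ^^ i) h) \<in> range (S ^^ n)"
      using Alg_Lat_polynomial_mod_range[OF S L LS A \<open>L p = 0\<close> \<open>p \<noteq> 0\<close>] by blast
    have "ell2_fun (A f) v = (\<Sum>i\<le>d v. a i * ell2_fun ((S ^^ i) f) v)" for f v
    proof -
      \<comment> \<open>After \<open>d v + 1\<close> terms the remainder lies in the range of a
        power exceeding the depth of \<open>v\<close>, so it vanishes at \<open>v\<close>.\<close>
      obtain g where "A f - (\<Sum>i<Suc (d v). a i *\<^sub>C (S ^^ i) f) = (S ^^ Suc (d v)) g"
        using a[of f "Suc (d v)"] by auto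
      then have "ell2_fun (A f - (\<Sum>i<Suc (d v). a i *\<^sub>C (S ^^ i) f)) v = 0"
        using shift_power_zero[OF tree dom d, where v=v and i="Suc (d v)" and f=g] by (simp add: S_def)
      then show ?thesis
        by (simp add: ell2_fun_diff ell2_fun_sum ell2_fun_scaleC lessThan_Suc_atMost del: sum.lessThan_Suc)
    qed
    then show ?thesis
      using A multiplier_in_W_alg[OF tree dom d, where A=A and a=a] by (simp add: S_def Alg_def)
  qed
  then show ?thesis
    using W_alg_subset_Alg_Lat[OF S] unfolding reflexive_operator_def S_def by blast
qed

end
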